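(* Let $\mathbf{P} \colon \mathsf{C}^{\mathrm{op}} \to \mathsf{BA}$ be a Boolean doctrine, let $(F_X)_{X \in \mathsf{C}}$ be a universal filter for $\mathbf{P}$ and let $(I_X)_{X \in \mathsf{C}}$ be a universal ideal for $\mathbf{P}$. Suppose that, for all $X\in\mathsf{C}$, $F_X\cap I_X=\varnothing$. Then there is a universal ultrafilter $(G_X)_{X\in\mathsf{C}}$ for $\mathbf{P}$ such that, for all $X \in \mathsf{C}$, $F_X \subseteq G_X$ and $G_X \cap I_X = \varnothing$.
   Context: $\mathsf{BA}$ denotes the category of Boolean algebras and Boolean homomorphisms. A Boolean doctrine over a category $\mathsf{C}$ with finite products is a functor $\mathbf{P} \colon \mathsf{C}^{\mathrm{op}} \to \mathsf{BA}$; $\mathbf{t}$ denotes the terminal object of $\mathsf{C}$ and $\mathrm{pr}_i$ the product projections. A universal filter for $\mathbf{P}$ is a family $(F_X)_{X \in \mathsf{C}}$ with $F_X \subseteq \mathbf{P}(X)$ such that: (a) for all $f \colon X \to Y$ and $\alpha \in F_Y$, $\mathbf{P}(f)(\alpha) \in F_X$; (b) each $F_X$ is a filter of $\mathbf{P}(X)$. A universal ideal for $\mathbf{P}$ is a family $(I_X)_{X \in \mathsf{C}}$ with $I_X \subseteq \mathbf{P}(X)$ such that: (a) for all $m \in \mathbb{N}$, morphisms $(f_j \colon X \to Y)_{j = 1, \dots, m}$ and $\alpha \in \mathbf{P}(Y)$, if $\bigwedge_{j = 1}^m \mathbf{P}(f_j)(\alpha) \in I_X$ then $\alpha \in I_Y$;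 (b) each $I_X$ is downward closed; (c) for all $\alpha_1 \in I_{X_1}$ and $\alpha_2 \in I_{X_2}$, $\mathbf{P}(\mathrm{pr}_1)(\alpha_1) \lor \mathbf{P}(\mathrm{pr}_2)(\alpha_2) \in I_{X_1 \times X_2}$; (d) $\bot_{\mathbf{P}(\mathbf{t})} \in I_\mathbf{t}$. A universal ultrafilter for $\mathbf{P}$ is a family $(F_X)_{X \in \mathsf{C}}$ with $F_X \subseteq \mathbf{P}(X)$ such that: (a) for all $f \colon X \to Y$ and $\alpha \in F_Y$, $\mathbf{P}(f)(\alpha) \in F_X$; (b) each $F_X$ is a filter of $\mathbf{P}(X)$; (c) for all $\alpha_1 \in \mathbf{P}(X_1)$ and $\alpha_2 \in \mathbf{P}(X_2)$, if $\mathbf{P}(\mathrm{pr}_1)(\alpha_1)\lor \mathbf{P}(\mathrm{pr}_2)(\alpha_2)\in F_{X_1\times X_2}$ then $\alpha_1 \in F_{X_1}$ or $\alpha_2\in F_{X_2}$; (d) $\bot_{\mathbf{P}(\mathbf{t})}\notin F_\mathbf{t}$. Equivalently, a universal filter whose fiberwise complement is a universal ideal. *)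

theory Defs
  imports "HOL-Algebra.Lattice"
begin

record ('o, 'm) category_data =
  Obj :: "'o set"
  Arr :: "'m set"
  Dom :: "'m \<Rightarrow> 'o"
  Cod :: "'m \<Rightarrow> 'o"
  Id :: "'o \<Rightarrow> 'm"
  Comp :: "'m \<Rightarrow> 'm \<Rightarrow> 'm"

definition Hom :: "('o, 'm, 'r) category_data_scheme \<Rightarrow> 'o \<Rightarrow> 'o \<Rightarrow> 'm set" where
  "Hom C X Y = {f \<in> Arr C. Dom C f = X \<and> Cod C f = Y}"

text \<open>Composition is in the usual order: \<^term>\<open>Comp C g f\<close> is \<open>g \<circ> f\<close>.\<close>

locale category =
  fixes C :: "('o, 'm, 'r) category_data_scheme"
  assumes Dom_Obj: "f \<in> Arr C \<Longrightarrow> Dom C f \<in> Obj C"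
    and Cod_Obj: "f \<in> Arr C \<Longrightarrow> Cod C f \<in> Obj C"
    and Id_Hom: "X \<in> Obj C \<Longrightarrow> Id C X \<in> Hom C X X"
    and Comp_Hom: "\<lbrakk>f \<in> Hom C X Y; g \<in> Hom C Y Z\<rbrakk> \<Longrightarrow> Comp C g f \<in> Hom C X Z"
    and Comp_Id_right: "f \<in> Hom C X Y \<Longrightarrow> Comp C f (Id C X) = f"
    and Comp_Id_left: "f \<in> Hom C X Y \<Longrightarrow> Comp C (Id C Y) f = f"
    and Comp_assoc: "\<lbrakk>f \<in> Hom C W X; g \<in> Hom C X Y; h \<in> Hom C Y Z\<rbrakk>
      \<Longrightarrow> Comp C h (Comp C g f) = Comp C (Comp C h g) f"

text \<open>Finite products are given by a choice of a terminal object and of binary products.\<close>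

record ('o, 'm) fp_category_data = "('o, 'm) category_data" +
  Term :: "'o"
  Prd :: "'o \<Rightarrow> 'o \<Rightarrow> 'o"
  Pr1 :: "'o \<Rightarrow> 'o \<Rightarrow> 'm"
  Pr2 :: "'o \<Rightarrow> 'o \<Rightarrow> 'm"

locale finite_product_category = category C
  for C :: "('o, 'm, 'r) fp_category_data_scheme" +
  assumes Term_Obj: "Term C \<in> Obj C"
    and Term_universal: "X \<in> Obj C \<Longrightarrow> \<exists>!f. f \<in> Hom C X (Term C)"
    and Prd_Obj: "\<lbrakk>X \<in> Obj C; Y \<in> Obj C\<rbrakk> \<Longrightarrow> Prd C X Y \<in> Obj C"
    and Pr1_Hom: "\<lbrakk>X \<in> Obj C; Y \<in> Obj C\<rbrakk> \<Longrightarrow> Pr1 C X Y \<in> Hom C (Prd C X Y) X"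
    and Pr2_Hom: "\<lbrakk>X \<in> Obj C; Y \<in> Obj C\<rbrakk> \<Longrightarrow> Pr2 C X Y \<in> Hom C (Prd C X Y) Y"
    and Prd_universal: "\<lbrakk>f \<in> Hom C Z X; g \<in> Hom C Z Y\<rbrakk>
      \<Longrightarrow> \<exists>!h. h \<in> Hom C Z (Prd C X Y) \<and> Comp C (Pr1 C X Y) h = f \<and> Comp C (Pr2 C X Y) h = g"

text \<open>The one-element algebra is allowed: \<open>\<bottom> = \<top>\<close> is not excluded.\<close>

locale bool_alg = bounded_lattice L for L :: "('a, 'b) gorder_scheme" (structure) +
  assumes meet_join_distrib: "\<lbrakk>x \<in> carrier L; y \<in> carrier L; z \<in> carrier L\<rbrakk>
      \<Longrightarrow> x \<sqinter> (y \<squnion> z) = (x \<sqinter> y) \<squnion> (x \<sqinter> z)"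
    and complement_exists: "x \<in> carrier L
      \<Longrightarrow> \<exists>y \<in> carrier L. x \<sqinter> y = \<bottom> \<and> x \<squnion> y = \<top>"

text \<open>Preservation of complements follows, as complements are unique.\<close>

definition bool_hom ::
  "('a, 'b) gorder_scheme \<Rightarrow> ('c, 'd) gorder_scheme \<Rightarrow> ('a \<Rightarrow> 'c) \<Rightarrow> bool" where
  "bool_hom L M h \<longleftrightarrow>
     h \<in> carrier L \<rightarrow> carrier M \<and>
     (\<forall>x\<in>carrier L. \<forall>y\<in>carrier L. h (x \<sqinter>\<^bsub>L\<^esub> y) = h x \<sqinter>\<^bsub>M\<^esub> h y) \<and>
     (\<forall>x\<in>carrier L. \<forall>y\<in>carrier L. h (x \<squnion>\<^bsub>L\<^esub> y) = h x \<squnion>\<^bsub>M\<^esub> h y) \<and>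
     h \<bottom>\<^bsub>L\<^esub> = \<bottom>\<^bsub>M\<^esub> \<and>
     h \<top>\<^bsub>L\<^esub> = \<top>\<^bsub>M\<^esub>"

text \<open>Filters are not required to be proper.\<close>

definition ba_filter :: "('a, 'b) gorder_scheme \<Rightarrow> 'a set \<Rightarrow> bool" where
  "ba_filter L F \<longleftrightarrow>
     F \<subseteq> carrier L \<and>
     \<top>\<^bsub>L\<^esub> \<in> F \<and>
     (\<forall>x\<in>F. \<forall>y\<in>F. x \<sqinter>\<^bsub>L\<^esub> y \<in> F) \<and>
     (\<forall>x\<in>F. \<forall>y\<in>carrier L. x \<sqsubseteq>\<^bsub>L\<^esub> y \<longrightarrow> y \<in> F)"

text \<open>
  A contravariant functor into Boolean algebras: \<open>P\<close> is its action on objects and \<open>R\<close> its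
  action on morphisms, where only the values of \<open>R f\<close> on the carrier of \<open>P (Cod C f)\<close> matter.
\<close>

locale boolean_doctrine = finite_product_category C
  for C :: "('o, 'm, 'r) fp_category_data_scheme" +
  fixes P :: "'o \<Rightarrow> ('a, 'b) gorder_scheme"
    and R :: "'m \<Rightarrow> 'a \<Rightarrow> 'a"
  assumes P_bool_alg: "X \<in> Obj C \<Longrightarrow> bool_alg (P X)"
    and R_bool_hom: "f \<in> Hom C X Y \<Longrightarrow> bool_hom (P Y) (P X) (R f)"
    and R_Id: "\<lbrakk>X \<in> Obj C; \<alpha> \<in> carrier (P X)\<rbrakk> \<Longrightarrow> R (Id C X) \<alpha> = \<alpha>"
    and R_Comp: "\<lbrakk>f \<in> Hom C X Y; g \<in> Hom C Y Z; \<alpha> \<in> carrier (P Z)\<rbrakk>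
      \<Longrightarrow> R (Comp C g f) \<alpha> = R f (R g \<alpha>)"

definition universal_filter ::
  "('o, 'm, 'r) fp_category_data_scheme \<Rightarrow> ('o \<Rightarrow> ('a, 'b) gorder_scheme) \<Rightarrow> ('m \<Rightarrow> 'a \<Rightarrow> 'a)
    \<Rightarrow> ('o \<Rightarrow> 'a set) \<Rightarrow> bool" where
  "universal_filter C P R F \<longleftrightarrow>
     (\<forall>X\<in>Obj C. \<forall>Y\<in>Obj C. \<forall>f\<in>Hom C X Y. \<forall>\<alpha>\<in>F Y. R f \<alpha> \<in> F X) \<and>
     (\<forall>X\<in>Obj C. ba_filter (P X) (F X))"

text \<open>
  For \<open>m = 0\<close> the meet in the first clause below is the infimum of the empty set, that is, the
  top element of \<open>P X\<close>.
\<close>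

definition universal_ideal ::
  "('o, 'm, 'r) fp_category_data_scheme \<Rightarrow> ('o \<Rightarrow> ('a, 'b) gorder_scheme) \<Rightarrow> ('m \<Rightarrow> 'a \<Rightarrow> 'a)
    \<Rightarrow> ('o \<Rightarrow> 'a set) \<Rightarrow> bool" where
  "universal_ideal C P R I \<longleftrightarrow>
     (\<forall>X\<in>Obj C. I X \<subseteq> carrier (P X)) \<and>
     (\<forall>X\<in>Obj C. \<forall>Y\<in>Obj C. \<forall>(m::nat) (f :: nat \<Rightarrow> 'm). \<forall>\<alpha>\<in>carrier (P Y).
        (\<forall>j\<in>{1..m}. f j \<in> Hom C X Y) \<longrightarrow>
        \<Sqinter>\<^bsub>P X\<^esub> ((\<lambda>j. R (f j) \<alpha>) ` {1..m}) \<in> I X \<longrightarrow> \<alpha> \<in> I Y) \<and>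
     (\<forall>X\<in>Obj C. \<forall>\<alpha>\<in>I X. \<forall>\<beta>\<in>carrier (P X). \<beta> \<sqsubseteq>\<^bsub>P X\<^esub> \<alpha> \<longrightarrow> \<beta> \<in> I X) \<and>
     (\<forall>X1\<in>Obj C. \<forall>X2\<in>Obj C. \<forall>\<alpha>1\<in>I X1. \<forall>\<alpha>2\<in>I X2.
        R (Pr1 C X1 X2) \<alpha>1 \<squnion>\<^bsub>P (Prd C X1 X2)\<^esub> R (Pr2 C X1 X2) \<alpha>2 \<in> I (Prd C X1 X2)) \<and>
     \<bottom>\<^bsub>P (Term C)\<^esub> \<in> I (Term C)"

definition universal_ultrafilter ::
  "('o, 'm, 'r) fp_category_data_scheme \<Rightarrow> ('o \<Rightarrow> ('a, 'b) gorder_scheme) \<Rightarrow> ('m \<Rightarrow> 'a \<Rightarrow> 'a)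
    \<Rightarrow> ('o \<Rightarrow> 'a set) \<Rightarrow> bool" where
  "universal_ultrafilter C P R F \<longleftrightarrow>
     (\<forall>X\<in>Obj C. \<forall>Y\<in>Obj C. \<forall>f\<in>Hom C X Y. \<forall>\<alpha>\<in>F Y. R f \<alpha> \<in> F X) \<and>
     (\<forall>X\<in>Obj C. ba_filter (P X) (F X)) \<and>
     (\<forall>X1\<in>Obj C. \<forall>X2\<in>Obj C. \<forall>\<alpha>1\<in>carrier (P X1). \<forall>\<alpha>2\<in>carrier (P X2).
        R (Pr1 C X1 X2) \<alpha>1 \<squnion>\<^bsub>P (Prd C X1 X2)\<^esub> R (Pr2 C X1 X2) \<alpha>2 \<in> F (Prd C X1 X2) \<longrightarrow>
        \<alpha>1 \<in> F X1 \<or> \<alpha>2 \<in> F X2) \<and>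
     \<bottom>\<^bsub>P (Term C)\<^esub> \<notin> F (Term C)"

end

theory Submission
  imports Defs
begin

text \<open>
  By Zorn's lemma choose \<open>G\<close> maximal among the universal filters that contain \<open>F\<close> and are disjoint
  from \<open>I\<close>. For a fixed \<open>\<rho>\<close> over \<open>Y\<close>, the elements \<open>\<beta>\<close> whose external join \<open>pr1 \<beta> \<or> pr2 \<rho>\<close> lies in
  \<open>G\<close> again form a universal filter containing \<open>G\<close>. If \<open>pr1 \<alpha>1 \<or> pr2 \<alpha>2\<close> is in \<open>G\<close> while neither
  \<open>\<alpha>1\<close> nor \<open>\<alpha>2\<close> is, maximality therefore allows \<open>\<alpha>1\<close>, and then \<open>\<alpha>2\<close>, to be replaced by an element
  of \<open>I\<close>; the resulting external join lies in both \<open>G\<close> and \<open>I\<close>, a contradiction.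
\<close>

lemma (in weak_upper_semilattice) join_mono_left:
  assumes "x \<sqsubseteq> y" "x \<in> carrier L" "y \<in> carrier L" "z \<in> carrier L"
  shows "x \<squnion> z \<sqsubseteq> y \<squnion> z"
proof (rule join_le)
  show "x \<sqsubseteq> y \<squnion> z"
    using assms join_left[of y z] by (meson join_closed le_trans)
qed (use assms in \<open>simp_all add: join_right\<close>)

lemma (in bool_alg) join_meet_distrib:
  assumes [simp]: "x \<in> carrier L" "y \<in> carrier L" "z \<in> carrier L"
  shows "(x \<sqinter> y) \<squnion> z = (x \<squnion> z) \<sqinter> (y \<squnion> z)"
proof -
  have absorb_meet: "(x \<squnion> z) \<sqinter> z = z"
    using le_iff_join[of z "x \<squnion> z"] by (simp add: join_right meet_comm)
  have absorb_join: "(y \<sqinter> z) \<squnion> z = z"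
    using le_iff_meet[of "y \<sqinter> z" z] by (simp add: meet_right)
  have "(x \<squnion> z) \<sqinter> (y \<squnion> z) = ((x \<squnion> z) \<sqinter> y) \<squnion> ((x \<squnion> z) \<sqinter> z)"
    by (simp add: meet_join_distrib)
  also have "\<dots> = ((x \<squnion> z) \<sqinter> y) \<squnion> z"
    by (simp add: absorb_meet)
  also have "\<dots> = ((x \<sqinter> y) \<squnion> (y \<sqinter> z)) \<squnion> z"
    by (simp add: meet_join_distrib meet_comm)
  also have "\<dots> = (x \<sqinter> y) \<squnion> ((y \<sqinter> z) \<squnion> z)"
    using weak_join_assoc eq_is_equal by simp
  finally show ?thesis
    by (simp add: absorb_join)
qed

lemma bool_hom_closed: "\<lbrakk>bool_hom L M h; x \<in> carrier L\<rbrakk> \<Longrightarrow> h x \<in> carrier M"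
  unfolding bool_hom_def by blast

lemma bool_hom_meet:
  "\<lbrakk>bool_hom L M h; x \<in> carrier L; y \<in> carrier L\<rbrakk> \<Longrightarrow> h (x \<sqinter>\<^bsub>L\<^esub> y) = h x \<sqinter>\<^bsub>M\<^esub> h y"
  unfolding bool_hom_def by blast

lemma bool_hom_join:
  "\<lbrakk>bool_hom L M h; x \<in> carrier L; y \<in> carrier L\<rbrakk> \<Longrightarrow> h (x \<squnion>\<^bsub>L\<^esub> y) = h x \<squnion>\<^bsub>M\<^esub> h y"
  unfolding bool_hom_def by blast

lemma bool_hom_top: "bool_hom L M h \<Longrightarrow> h \<top>\<^bsub>L\<^esub> = \<top>\<^bsub>M\<^esub>"
  unfolding bool_hom_def by blast

lemma bool_hom_isotone:
  assumes "lattice L" "lattice M" "bool_hom L M h"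
  shows "isotone L M h"
  using assms by (intro join_pres_isotone) (auto simp: bool_hom_def join_pres_def)

lemma ba_filterI:
  assumes "F \<subseteq> carrier L" and "\<top>\<^bsub>L\<^esub> \<in> F"
    and "\<And>x y. \<lbrakk>x \<in> F; y \<in> F\<rbrakk> \<Longrightarrow> x \<sqinter>\<^bsub>L\<^esub> y \<in> F"
    and "\<And>x y. \<lbrakk>x \<in> F; y \<in> carrier L; x \<sqsubseteq>\<^bsub>L\<^esub> y\<rbrakk> \<Longrightarrow> y \<in> F"
  shows "ba_filter L F"
  using assms unfolding ba_filter_def by blast

lemma ba_filter_carrier: "ba_filter L F \<Longrightarrow> F \<subseteq> carrier L"
  unfolding ba_filter_def by blast

lemma ba_filter_top: "ba_filter L F \<Longrightarrow> \<top>\<^bsub>L\<^esub> \<in> F"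
  unfolding ba_filter_def by blast

lemma ba_filter_meet: "\<lbrakk>ba_filter L F; x \<in> F; y \<in> F\<rbrakk> \<Longrightarrow> x \<sqinter>\<^bsub>L\<^esub> y \<in> F"
  unfolding ba_filter_def by blast

lemma ba_filter_upward: "\<lbrakk>ba_filter L F; x \<in> F; y \<in> carrier L; x \<sqsubseteq>\<^bsub>L\<^esub> y\<rbrakk> \<Longrightarrow> y \<in> F"
  unfolding ba_filter_def by blast

lemma ba_filter_vimage:
  assumes "bounded_lattice L" "lattice M" and h: "bool_hom L M h" and F: "ba_filter M F"
  shows "ba_filter L (h -` F \<inter> carrier L)" (is "ba_filter L ?K")
proof -
  interpret L: bounded_lattice L by fact
  show ?thesis
  proof (rule ba_filterI)
    show "\<top>\<^bsub>L\<^esub> \<in> ?K"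
      by (simp add: bool_hom_top[OF h] ba_filter_top[OF F])
  next
    fix x y assume "x \<in> ?K" "y \<in> ?K"
    then show "x \<sqinter>\<^bsub>L\<^esub> y \<in> ?K"
      by (simp add: bool_hom_meet[OF h] ba_filter_meet[OF F])
  next
    fix x y assume x: "x \<in> ?K" and y: "y \<in> carrier L" and "x \<sqsubseteq>\<^bsub>L\<^esub> y"
    then have "h x \<sqsubseteq>\<^bsub>M\<^esub> h y"
      using use_iso2[OF bool_hom_isotone[OF L.lattice_axioms \<open>lattice M\<close> h]] by blast
    then show "y \<in> ?K"
      using ba_filter_upward[OF F _ bool_hom_closed[OF h y]] x y by blast
  qed simp
qed

lemma (in bool_alg) ba_filter_join_residual:
  assumes F: "ba_filter L F" and [simp]: "r \<in> carrier L"
  shows "ba_filter L {x \<in> carrier L. x \<squnion> r \<in> F}" (is "ba_filter L ?K")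
proof (rule ba_filterI)
  have "\<top> \<squnion> r = \<top>"
    using le_iff_meet[of r \<top>] by (simp add: join_comm top_higher)
  then show "\<top> \<in> ?K"
    using ba_filter_top[OF F] by simp
next
  fix x y assume "x \<in> ?K" "y \<in> ?K"
  then show "x \<sqinter> y \<in> ?K"
    by (simp add: join_meet_distrib ba_filter_meet[OF F])
next
  fix x y assume x: "x \<in> ?K" and y: "y \<in> carrier L" and "x \<sqsubseteq> y"
  then have "x \<squnion> r \<sqsubseteq> y \<squnion> r"
    by (simp add: join_mono_left)
  then show "y \<in> ?K"
    using ba_filter_upward[OF F, of "x \<squnion> r" "y \<squnion> r"] x y by simp
qed simp

lemma ba_filter_Union_chain:
  assumes "\<F> \<noteq> {}" and filters: "\<And>F. F \<in> \<F> \<Longrightarrow> ba_filter L F" and chain: "chain\<^sub>\<subseteq> \<F>"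
  shows "ba_filter L (\<Union>\<F>)"
proof (rule ba_filterI)
  show "\<Union>\<F> \<subseteq> carrier L"
    using ba_filter_carrier[OF filters] by blast
  show "\<top>\<^bsub>L\<^esub> \<in> \<Union>\<F>"
    using \<open>\<F> \<noteq> {}\<close> ba_filter_top[OF filters] by blast
next
  fix x y assume "x \<in> \<Union>\<F>" "y \<in> \<Union>\<F>"
  then obtain F where "F \<in> \<F>" "x \<in> F" "y \<in> F"
    using chain unfolding chain_subset_def by blast
  then show "x \<sqinter>\<^bsub>L\<^esub> y \<in> \<Union>\<F>"
    using ba_filter_meet[OF filters] by blast
next
  fix x y assume "x \<in> \<Union>\<F>" "y \<in> carrier L" "x \<sqsubseteq>\<^bsub>L\<^esub> y"
  then show "y \<in> \<Union>\<F>"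
    using ba_filter_upward[OF filters] by blast
qed

definition subfamily_on :: "'i set \<Rightarrow> ('i \<Rightarrow> 'a set) \<Rightarrow> ('i \<Rightarrow> 'a set) \<Rightarrow> bool" where
  "subfamily_on A G H \<longleftrightarrow> (\<forall>i\<in>A. G i \<subseteq> H i)"

lemma subfamily_on_iff_Sigma: "subfamily_on A G H \<longleftrightarrow> Sigma A G \<subseteq> Sigma A H"
  unfolding subfamily_on_def by auto

lemma Zorn_families:
  assumes "Q F"
    and Union: "\<And>\<G>. \<lbrakk>\<G> \<noteq> {}; \<And>G. G \<in> \<G> \<Longrightarrow> Q G;
        \<And>G H. \<lbrakk>G \<in> \<G>; H \<in> \<G>\<rbrakk> \<Longrightarrow> subfamily_on A G H \<or> subfamily_on A H G\<rbrakk>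
      \<Longrightarrow> Q (\<lambda>i. \<Union>G\<in>\<G>. G i)"
  obtains G where "Q G" "subfamily_on A F G"
    "\<And>H. \<lbrakk>Q H; subfamily_on A G H\<rbrakk> \<Longrightarrow> subfamily_on A H G"
proof -
  define \<E> where "\<E> = {G. Q G \<and> subfamily_on A F G}"
  \<comment> \<open>Inclusion over \<open>A\<close> is only a preorder on families, so Zorn's lemma is applied
    to their graphs over \<open>A\<close>.\<close>
  have "\<exists>M\<in>Sigma A ` \<E>. \<forall>N\<in>Sigma A ` \<E>. M \<subseteq> N \<longrightarrow> N = M"
  proof (rule subset_Zorn_nonempty)
    show "Sigma A ` \<E> \<noteq> {}"
      using \<open>Q F\<close> unfolding \<E>_def subfamily_on_def by blast
  next
    fix \<C> assume "\<C> \<noteq> {}" and chain: "subset.chain (Sigma A ` \<E>) \<C>"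
    then obtain \<G> where "\<G> \<subseteq> \<E>" and \<C>: "\<C> = Sigma A ` \<G>"
      unfolding subset_chain_def subset_image_iff by (elim conjE exE)
    with \<open>\<C> \<noteq> {}\<close> have "\<G> \<noteq> {}"
      by simp
    moreover have "subfamily_on A G H \<or> subfamily_on A H G" if "G \<in> \<G>" "H \<in> \<G>" for G H
      using chain that unfolding \<C> subset_chain_def subfamily_on_iff_Sigma by simp
    ultimately have "Q (\<lambda>i. \<Union>G\<in>\<G>. G i)"
      using \<open>\<G> \<subseteq> \<E>\<close> unfolding \<E>_def by (intro Union) auto
    moreover have "subfamily_on A F (\<lambda>i. \<Union>G\<in>\<G>. G i)"
      using \<open>\<G> \<noteq> {}\<close> \<open>\<G> \<subseteq> \<E>\<close> unfolding \<E>_def subfamily_on_def by fast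
    moreover have "\<Union>\<C> = Sigma A (\<lambda>i. \<Union>G\<in>\<G>. G i)"
      unfolding \<C> by auto
    ultimately show "\<Union>\<C> \<in> Sigma A ` \<E>"
      unfolding \<E>_def by simp
  qed
  then obtain G where G: "Q G" "subfamily_on A F G"
    and maximal: "\<And>H. \<lbrakk>H \<in> \<E>; Sigma A G \<subseteq> Sigma A H\<rbrakk> \<Longrightarrow> Sigma A H = Sigma A G"
    unfolding \<E>_def by auto
  have "subfamily_on A H G" if "Q H" "subfamily_on A G H" for H
  proof -
    have "H \<in> \<E>"
      using that G(2) unfolding \<E>_def subfamily_on_def by blast
    then show ?thesis
      using maximal that(2) unfolding subfamily_on_iff_Sigma by blast
  qed
  with G show thesis
    by (rule that)
qed

lemma (in category) Hom_Dom_Obj: "f \<in> Hom C X Y \<Longrightarrow> X \<in> Obj C"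
  using Dom_Obj unfolding Hom_def by blast

lemma (in category) Hom_Cod_Obj: "f \<in> Hom C X Y \<Longrightarrow> Y \<in> Obj C"
  using Cod_Obj unfolding Hom_def by blast

context boolean_doctrine
begin

lemma R_closed: "\<lbrakk>f \<in> Hom C X Y; \<alpha> \<in> carrier (P Y)\<rbrakk> \<Longrightarrow> R f \<alpha> \<in> carrier (P X)"
  by (rule bool_hom_closed[OF R_bool_hom])

definition external_join :: "'o \<Rightarrow> 'o \<Rightarrow> 'a \<Rightarrow> 'a \<Rightarrow> 'a" where
  "external_join X Y \<alpha> \<beta> = R (Pr1 C X Y) \<alpha> \<squnion>\<^bsub>P (Prd C X Y)\<^esub> R (Pr2 C X Y) \<beta>"

lemma external_join_pullback:
  assumes f: "f \<in> Hom C Z X" and g: "g \<in> Hom C Z Y"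
    and \<alpha>: "\<alpha> \<in> carrier (P X)" and \<beta>: "\<beta> \<in> carrier (P Y)"
  obtains h where "h \<in> Hom C Z (Prd C X Y)"
    "R h (external_join X Y \<alpha> \<beta>) = R f \<alpha> \<squnion>\<^bsub>P Z\<^esub> R g \<beta>"
proof -
  have pr1: "Pr1 C X Y \<in> Hom C (Prd C X Y) X" and pr2: "Pr2 C X Y \<in> Hom C (Prd C X Y) Y"
    using Hom_Cod_Obj[OF f] Hom_Cod_Obj[OF g] by (rule Pr1_Hom, rule Pr2_Hom)
  obtain h where h: "h \<in> Hom C Z (Prd C X Y)"
    and fg: "Comp C (Pr1 C X Y) h = f" "Comp C (Pr2 C X Y) h = g"
    using Prd_universal[OF f g] by blast
  have "R h (external_join X Y \<alpha> \<beta>) = R h (R (Pr1 C X Y) \<alpha>) \<squnion>\<^bsub>P Z\<^esub> R h (R (Pr2 C X Y) \<beta>)"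
    unfolding external_join_def
    using bool_hom_join[OF R_bool_hom[OF h] R_closed[OF pr1 \<alpha>] R_closed[OF pr2 \<beta>]] .
  also have "\<dots> = R f \<alpha> \<squnion>\<^bsub>P Z\<^esub> R g \<beta>"
    using R_Comp[OF h pr1 \<alpha>] R_Comp[OF h pr2 \<beta>] fg by simp
  finally show thesis
    by (rule that[OF h])
qed

lemma universal_filterI:
  assumes "\<And>X Y f \<alpha>. \<lbrakk>f \<in> Hom C X Y; \<alpha> \<in> G Y\<rbrakk> \<Longrightarrow> R f \<alpha> \<in> G X"
    and "\<And>X. X \<in> Obj C \<Longrightarrow> ba_filter (P X) (G X)"
  shows "universal_filter C P R G"
  using assms unfolding universal_filter_def by blast

lemma universal_filter_reindex:
  assumes "universal_filter C P R G" "f \<in> Hom C X Y" "\<alpha> \<in> G Y"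
  shows "R f \<alpha> \<in> G X"
  using assms Hom_Dom_Obj Hom_Cod_Obj unfolding universal_filter_def by blast

lemma universal_filter_ba_filter:
  "\<lbrakk>universal_filter C P R G; X \<in> Obj C\<rbrakk> \<Longrightarrow> ba_filter (P X) (G X)"
  unfolding universal_filter_def by blast

lemma universal_filter_external_join_pullback:
  assumes G: "universal_filter C P R G"
    and f: "f \<in> Hom C Z X" and g: "g \<in> Hom C Z Y"
    and \<alpha>: "\<alpha> \<in> carrier (P X)" and \<beta>: "\<beta> \<in> carrier (P Y)"
    and join: "external_join X Y \<alpha> \<beta> \<in> G (Prd C X Y)"
  shows "R f \<alpha> \<squnion>\<^bsub>P Z\<^esub> R g \<beta> \<in> G Z"
proof -
  obtain h where h: "h \<in> Hom C Z (Prd C X Y)"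
    and "R h (external_join X Y \<alpha> \<beta>) = R f \<alpha> \<squnion>\<^bsub>P Z\<^esub> R g \<beta>"
    using external_join_pullback[OF f g \<alpha> \<beta>] .
  then show ?thesis
    using universal_filter_reindex[OF G h join] by simp
qed

lemma universal_filter_external_join_swap:
  assumes G: "universal_filter C P R G" and X: "X \<in> Obj C" and Y: "Y \<in> Obj C"
    and \<alpha>: "\<alpha> \<in> carrier (P X)" and \<beta>: "\<beta> \<in> carrier (P Y)"
    and join: "external_join X Y \<alpha> \<beta> \<in> G (Prd C X Y)"
  shows "external_join Y X \<beta> \<alpha> \<in> G (Prd C Y X)"
proof -
  have "R (Pr2 C Y X) \<alpha> \<squnion>\<^bsub>P (Prd C Y X)\<^esub> R (Pr1 C Y X) \<beta> \<in> G (Prd C Y X)"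
    using G Pr2_Hom[OF Y X] Pr1_Hom[OF Y X] \<alpha> \<beta> join
    by (rule universal_filter_external_join_pullback)
  then show ?thesis
    unfolding external_join_def by (subst join_comm)
qed

lemma universal_filter_Union_chain:
  assumes "\<G> \<noteq> {}" and filters: "\<And>G. G \<in> \<G> \<Longrightarrow> universal_filter C P R G"
    and chain: "\<And>G H. \<lbrakk>G \<in> \<G>; H \<in> \<G>\<rbrakk> \<Longrightarrow> subfamily_on (Obj C) G H \<or> subfamily_on (Obj C) H G"
  shows "universal_filter C P R (\<lambda>X. \<Union>G\<in>\<G>. G X)"
proof (rule universal_filterI)
  fix X Y f \<alpha> assume "f \<in> Hom C X Y" "\<alpha> \<in> (\<Union>G\<in>\<G>. G Y)"
  then show "R f \<alpha> \<in> (\<Union>G\<in>\<G>. G X)"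
    using universal_filter_reindex[OF filters] by blast
next
  fix X assume X: "X \<in> Obj C"
  show "ba_filter (P X) (\<Union>G\<in>\<G>. G X)"
  proof (rule ba_filter_Union_chain)
    show "chain\<^sub>\<subseteq> ((\<lambda>G. G X) ` \<G>)"
      using chain X unfolding chain_subset_def subfamily_on_def by blast
  qed (use \<open>\<G> \<noteq> {}\<close> universal_filter_ba_filter[OF filters X] in auto)
qed

definition residual :: "('o \<Rightarrow> 'a set) \<Rightarrow> 'o \<Rightarrow> 'a \<Rightarrow> 'o \<Rightarrow> 'a set" where
  "residual G Y \<rho> X = {\<beta> \<in> carrier (P X). external_join X Y \<beta> \<rho> \<in> G (Prd C X Y)}"

lemma subfamily_on_residual:
  assumes G: "universal_filter C P R G" and Y: "Y \<in> Obj C" and \<rho>: "\<rho> \<in> carrier (P Y)"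
  shows "subfamily_on (Obj C) G (residual G Y \<rho>)"
  unfolding subfamily_on_def
proof (intro ballI subsetI)
  fix X \<beta> assume X: "X \<in> Obj C" and \<beta>: "\<beta> \<in> G X"
  let ?Q = "Prd C X Y"
  have Q: "?Q \<in> Obj C" and pr1: "Pr1 C X Y \<in> Hom C ?Q X" and pr2: "Pr2 C X Y \<in> Hom C ?Q Y"
    using X Y by (rule Prd_Obj, rule Pr1_Hom, rule Pr2_Hom)
  interpret Q: bool_alg "P ?Q"
    using Q by (rule P_bool_alg)
  have \<beta>_carrier: "\<beta> \<in> carrier (P X)"
    using \<beta> ba_filter_carrier[OF universal_filter_ba_filter[OF G X]] by blast
  note [simp] = R_closed[OF pr1 \<beta>_carrier] R_closed[OF pr2 \<rho>]
  have "R (Pr1 C X Y) \<beta> \<in> G ?Q"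
    using G pr1 \<beta> by (rule universal_filter_reindex)
  then have "external_join X Y \<beta> \<rho> \<in> G ?Q"
    using ba_filter_upward[OF universal_filter_ba_filter[OF G Q]]
    unfolding external_join_def by (simp add: Q.join_left)
  with \<beta>_carrier show "\<beta> \<in> residual G Y \<rho> X"
    unfolding residual_def by blast
qed

lemma ba_filter_residual:
  assumes G: "universal_filter C P R G" and X: "X \<in> Obj C" and Y: "Y \<in> Obj C"
    and \<rho>: "\<rho> \<in> carrier (P Y)"
  shows "ba_filter (P X) (residual G Y \<rho> X)"
proof -
  let ?Q = "Prd C X Y"
  have Q: "?Q \<in> Obj C" and pr1: "Pr1 C X Y \<in> Hom C ?Q X" and pr2: "Pr2 C X Y \<in> Hom C ?Q Y"
    using X Y by (rule Prd_Obj, rule Pr1_Hom, rule Pr2_Hom)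
  interpret X: bool_alg "P X"
    using X by (rule P_bool_alg)
  interpret Q: bool_alg "P ?Q"
    using Q by (rule P_bool_alg)
  let ?K = "{\<gamma> \<in> carrier (P ?Q). \<gamma> \<squnion>\<^bsub>P ?Q\<^esub> R (Pr2 C X Y) \<rho> \<in> G ?Q}"
  have "ba_filter (P ?Q) ?K"
    using universal_filter_ba_filter[OF G Q] R_closed[OF pr2 \<rho>] by (rule Q.ba_filter_join_residual)
  then have "ba_filter (P X) (R (Pr1 C X Y) -` ?K \<inter> carrier (P X))"
    by (rule ba_filter_vimage[OF X.bounded_lattice_axioms Q.lattice_axioms R_bool_hom[OF pr1]])
  moreover have "residual G Y \<rho> X = R (Pr1 C X Y) -` ?K \<inter> carrier (P X)"
    unfolding residual_def external_join_def using R_closed[OF pr1] by auto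
  ultimately show ?thesis
    by simp
qed

lemma universal_filter_residual:
  assumes G: "universal_filter C P R G" and Y: "Y \<in> Obj C" and \<rho>: "\<rho> \<in> carrier (P Y)"
  shows "universal_filter C P R (residual G Y \<rho>)"
proof (rule universal_filterI)
  fix W X f \<beta> assume f: "f \<in> Hom C W X" and "\<beta> \<in> residual G Y \<rho> X"
  then have \<beta>: "\<beta> \<in> carrier (P X)" and join: "external_join X Y \<beta> \<rho> \<in> G (Prd C X Y)"
    unfolding residual_def by auto
  have pr1: "Pr1 C W Y \<in> Hom C (Prd C W Y) W" and pr2: "Pr2 C W Y \<in> Hom C (Prd C W Y) Y"
    using Hom_Dom_Obj[OF f] Y by (rule Pr1_Hom, rule Pr2_Hom)
  have "R (Comp C f (Pr1 C W Y)) \<beta> \<squnion>\<^bsub>P (Prd C W Y)\<^esub> R (Pr2 C W Y) \<rho> \<in> G (Prd C W Y)"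
    using G Comp_Hom[OF pr1 f] pr2 \<beta> \<rho> join by (rule universal_filter_external_join_pullback)
  then have "external_join W Y (R f \<beta>) \<rho> \<in> G (Prd C W Y)"
    unfolding external_join_def by (simp add: R_Comp[OF pr1 f \<beta>])
  then show "R f \<beta> \<in> residual G Y \<rho> W"
    unfolding residual_def using R_closed[OF f \<beta>] by blast
qed (rule ba_filter_residual[OF G _ Y \<rho>])

definition universal_filter_avoiding :: "('o \<Rightarrow> 'a set) \<Rightarrow> ('o \<Rightarrow> 'a set) \<Rightarrow> bool" where
  "universal_filter_avoiding I G \<longleftrightarrow>
     universal_filter C P R G \<and> (\<forall>X\<in>Obj C. G X \<inter> I X = {})"

definition maximal_universal_filter_avoiding :: "('o \<Rightarrow> 'a set) \<Rightarrow> ('o \<Rightarrow> 'a set) \<Rightarrow> bool" where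
  "maximal_universal_filter_avoiding I G \<longleftrightarrow>
     universal_filter_avoiding I G \<and>
     (\<forall>H. universal_filter_avoiding I H \<longrightarrow> subfamily_on (Obj C) G H \<longrightarrow> subfamily_on (Obj C) H G)"

lemma maximal_avoiding_universal_filter:
  "maximal_universal_filter_avoiding I G \<Longrightarrow> universal_filter C P R G"
  unfolding maximal_universal_filter_avoiding_def universal_filter_avoiding_def by blast

lemma maximal_avoiding_disjoint:
  "\<lbrakk>maximal_universal_filter_avoiding I G; X \<in> Obj C\<rbrakk> \<Longrightarrow> G X \<inter> I X = {}"
  unfolding maximal_universal_filter_avoiding_def universal_filter_avoiding_def by simp

lemma ex_maximal_universal_filter_avoiding:
  assumes "universal_filter_avoiding I F"
  obtains G where "maximal_universal_filter_avoiding I G" "subfamily_on (Obj C) F G"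
proof (rule Zorn_families[where Q = "universal_filter_avoiding I" and A = "Obj C"])
  show "universal_filter_avoiding I F"
    by fact
next
  fix \<G> :: "('o \<Rightarrow> 'a set) set"
  assume "\<G> \<noteq> {}" and avoiding: "\<And>G. G \<in> \<G> \<Longrightarrow> universal_filter_avoiding I G"
    and "\<And>G H. \<lbrakk>G \<in> \<G>; H \<in> \<G>\<rbrakk> \<Longrightarrow> subfamily_on (Obj C) G H \<or> subfamily_on (Obj C) H G"
  then have "universal_filter C P R (\<lambda>X. \<Union>G\<in>\<G>. G X)"
    by (intro universal_filter_Union_chain) (auto simp: universal_filter_avoiding_def)
  then show "universal_filter_avoiding I (\<lambda>X. \<Union>G\<in>\<G>. G X)"
    using avoiding unfolding universal_filter_avoiding_def by blast
next
  fix G assume "universal_filter_avoiding I G" "subfamily_on (Obj C) F G"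
    and "\<And>H. \<lbrakk>universal_filter_avoiding I H; subfamily_on (Obj C) G H\<rbrakk>
      \<Longrightarrow> subfamily_on (Obj C) H G"
  then show thesis
    by (intro that) (auto simp: maximal_universal_filter_avoiding_def)
qed

lemma maximal_avoiding_replace_by_avoided:
  assumes G: "maximal_universal_filter_avoiding I G"
    and X: "X \<in> Obj C" and Y: "Y \<in> Obj C"
    and \<alpha>: "\<alpha> \<in> carrier (P X)" "\<alpha> \<notin> G X" and \<rho>: "\<rho> \<in> carrier (P Y)"
    and join: "external_join X Y \<alpha> \<rho> \<in> G (Prd C X Y)"
  obtains Z \<beta> where "Z \<in> Obj C" "\<beta> \<in> I Z" "external_join Z Y \<beta> \<rho> \<in> G (Prd C Z Y)"
proof -
  note filter = maximal_avoiding_universal_filter[OF G]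
  have "\<alpha> \<in> residual G Y \<rho> X"
    using \<alpha>(1) join unfolding residual_def by blast
  then have "\<not> subfamily_on (Obj C) (residual G Y \<rho>) G"
    using X \<alpha>(2) unfolding subfamily_on_def by blast
  then have "\<not> universal_filter_avoiding I (residual G Y \<rho>)"
    using G subfamily_on_residual[OF filter Y \<rho>]
    unfolding maximal_universal_filter_avoiding_def by blast
  then obtain Z \<beta> where "Z \<in> Obj C" "\<beta> \<in> residual G Y \<rho> Z" "\<beta> \<in> I Z"
    using universal_filter_residual[OF filter Y \<rho>]
    unfolding universal_filter_avoiding_def by blast
  then show thesis
    using that unfolding residual_def by blast
qed

lemma maximal_avoiding_prime:
  assumes G: "maximal_universal_filter_avoiding I G"
    and I_carrier: "\<And>X. X \<in> Obj C \<Longrightarrow> I X \<subseteq> carrier (P X)"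
    and I_join: "\<And>X Y \<alpha> \<beta>. \<lbrakk>X \<in> Obj C; Y \<in> Obj C; \<alpha> \<in> I X; \<beta> \<in> I Y\<rbrakk>
      \<Longrightarrow> external_join X Y \<alpha> \<beta> \<in> I (Prd C X Y)"
    and X: "X \<in> Obj C" and Y: "Y \<in> Obj C"
    and \<alpha>: "\<alpha> \<in> carrier (P X)" and \<beta>: "\<beta> \<in> carrier (P Y)"
    and join: "external_join X Y \<alpha> \<beta> \<in> G (Prd C X Y)"
  shows "\<alpha> \<in> G X \<or> \<beta> \<in> G Y"
proof (rule ccontr)
  assume "\<not> (\<alpha> \<in> G X \<or> \<beta> \<in> G Y)"
  then have "\<alpha> \<notin> G X" "\<beta> \<notin> G Y"
    by simp_all
  obtain V \<gamma> where V: "V \<in> Obj C" and \<gamma>: "\<gamma> \<in> I V"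
    and "external_join V Y \<gamma> \<beta> \<in> G (Prd C V Y)"
    using maximal_avoiding_replace_by_avoided[OF G X Y \<alpha> \<open>\<alpha> \<notin> G X\<close> \<beta> join] .
  moreover have \<gamma>_carrier: "\<gamma> \<in> carrier (P V)"
    using I_carrier[OF V] \<gamma> by blast
  ultimately have "external_join Y V \<beta> \<gamma> \<in> G (Prd C Y V)"
    using maximal_avoiding_universal_filter[OF G] V Y \<beta>
    by (blast intro: universal_filter_external_join_swap)
  then obtain W \<delta> where W: "W \<in> Obj C" and "\<delta> \<in> I W"
    and "external_join W V \<delta> \<gamma> \<in> G (Prd C W V)"
    using maximal_avoiding_replace_by_avoided[OF G Y V \<beta> \<open>\<beta> \<notin> G Y\<close> \<gamma>_carrier] by blast
  then show False
    using I_join[OF W V _ \<gamma>] maximal_avoiding_disjoint[OF G Prd_Obj[OF W V]] by blast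
qed

lemma maximal_avoiding_universal_ultrafilter:
  assumes I: "universal_ideal C P R I" and G: "maximal_universal_filter_avoiding I G"
  shows "universal_ultrafilter C P R G"
proof -
  have I_carrier: "I X \<subseteq> carrier (P X)" if "X \<in> Obj C" for X
    using I that unfolding universal_ideal_def by blast
  have I_join: "external_join X Y \<alpha> \<beta> \<in> I (Prd C X Y)"
    if "X \<in> Obj C" "Y \<in> Obj C" "\<alpha> \<in> I X" "\<beta> \<in> I Y" for X Y \<alpha> \<beta>
    using I that unfolding universal_ideal_def external_join_def by blast
  have "\<bottom>\<^bsub>P (Term C)\<^esub> \<in> I (Term C)"
    using I unfolding universal_ideal_def by blast
  then have "\<bottom>\<^bsub>P (Term C)\<^esub> \<notin> G (Term C)"
    using maximal_avoiding_disjoint[OF G Term_Obj] by blast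
  moreover have "\<forall>X\<in>Obj C. \<forall>Y\<in>Obj C. \<forall>\<alpha>\<in>carrier (P X). \<forall>\<beta>\<in>carrier (P Y).
      external_join X Y \<alpha> \<beta> \<in> G (Prd C X Y) \<longrightarrow> \<alpha> \<in> G X \<or> \<beta> \<in> G Y"
    by (intro ballI impI maximal_avoiding_prime[OF G I_carrier I_join])
  ultimately show ?thesis
    using maximal_avoiding_universal_filter[OF G]
    unfolding universal_ultrafilter_def universal_filter_def external_join_def by simp
qed

end

theorem theorem3p18:
  fixes C :: "('o, 'm, 'r) fp_category_data_scheme"
    and P :: "'o \<Rightarrow> ('a, 'b) gorder_scheme"
    and R :: "'m \<Rightarrow> 'a \<Rightarrow> 'a"
    and F I :: "'o \<Rightarrow> 'a set"
  assumes "boolean_doctrine C P R"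
    and "universal_filter C P R F"
    and "universal_ideal C P R I"
    and "\<And>X. X \<in> Obj C \<Longrightarrow> F X \<inter> I X = {}"
  shows "\<exists>G. universal_ultrafilter C P R G \<and> (\<forall>X\<in>Obj C. F X \<subseteq> G X \<and> G X \<inter> I X = {})"
proof -
  interpret boolean_doctrine C P R by fact
  have "universal_filter_avoiding I F"
    using assms(2,4) unfolding universal_filter_avoiding_def by blast
  then obtain G where G: "maximal_universal_filter_avoiding I G" and FG: "subfamily_on (Obj C) F G"
    by (rule ex_maximal_universal_filter_avoiding)
  show ?thesis
  proof (intro exI[of _ G] conjI ballI)
    show "universal_ultrafilter C P R G"
      using assms(3) G by (rule maximal_avoiding_universal_ultrafilter)
    show "F X \<subseteq> G X" if "X \<in> Obj C" for X
      using FG that unfolding subfamily_on_def by blast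
    show "G X \<inter> I X = {}" if "X \<in> Obj C" for X
      using G that by (rule maximal_avoiding_disjoint)
  qed
qed

end
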